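(* Let $n, q, M, r$ be positive integers with $q\ge 2$. Assume that there exists a uniform collection $(C_0,\ldots,C_{M-1})$ of $M$ perfect $r$-colorings of $H(n,q)$, all with the same set of colors $K$ ($|K|=r$) and the same quotient matrix $S$, and assume that the first coloring $C_0$ essentially depends on all of its $n$ arguments. Assume also that there exists a perfect $Mq$-coloring $E$ of $H(M,q)$, with color set $\{0,1,\ldots,Mq-1\}$ and quotient matrix $T=(T_{j,l})$, where $T_{j,l}=0$ if $j\equiv l \bmod q$ and $T_{j,l}=1$ if $j\not\equiv l\bmod q$. Let $I$ be the $r\times r$ identity matrix and let $P$ be the $r\times r$ matrix each of whose rows is the density vector corresponding to $S$. Then for every nonnegative integer $i$ there exists a perfect coloring of $H(n_i,q)$, where $$n_i=\Big(n-\frac{M}{1-q}\Big)q^i+\frac{M}{1-q},$$ with quotient matrix $$S+(n_i-n-iM)(q-1)I+i(q-1)MP,$$ such that the coloring essentially depends on all of its $n_i$ arguments.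
   Context: The Hamming graph $H(n,q)$ ($n\ge 1$, $q\ge 2$) is the graph on the set $\Sigma^n$ of words of length $n$ over an alphabet $\Sigma$ of size $q$, two words being adjacent if and only if they differ in exactly one position. A $k$-coloring of a graph is a surjective function from its vertex set onto a finite set $K$ of $k$ colors. A $k$-coloring is perfect if there is a $k\times k$ matrix $(S_{i,j})_{i,j\in K}$ (the quotient matrix) such that every vertex of color $i$ has exactly $S_{i,j}$ neighbors of color $j$, for all $i,j\in K$. A function $f$ on the vertices of $H(n,q)$ essentially depends on its $i$th argument if there are two vertices $\bar x,\bar y$ differing in only the $i$th position such that $f(\bar x)\ne f(\bar y)$. A collection $(C_0,\ldots,C_{M-1})$ of colorings of $H(n,q)$ (repetitions allowed) is uniform if the multiset of colors $\{C_0(\bar x),\ldots,C_{M-1}(\bar x)\}$ does not depend on the vertex $\bar x$ of $H(n,q)$. The density $\rho(i)$ of color $i$ in a coloring of a finite graph is the proportion of vertices of color $i$ among all vertices; the density vector is the list of densities of all colors. For a perfect coloring of $H(n,q)$ the density vector is uniquely determined by the quotient matrix, because $\rho(i)S_{i,j}=\rho(j)S_{j,i}$; this is "the density vector corresponding to $S$". *)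

theory Defs
  imports Complex_Main "HOL-Library.Multiset" "Graph_Theory.Graph_Theory"
begin

definition words :: "'a set \<Rightarrow> nat \<Rightarrow> 'a list set" where
  "words \<Sigma> n = {x. length x = n \<and> set x \<subseteq> \<Sigma>}"

definition diff_positions :: "'a list \<Rightarrow> 'a list \<Rightarrow> nat set" where
  "diff_positions x y = {p. p < length x \<and> x ! p \<noteq> y ! p}"

text \<open>The Hamming graph \<open>H(n,q)\<close> with \<open>q = card \<Sigma>\<close>. An undirected edge is represented by its two
  opposite arcs, and positions are numbered from 0.\<close>

definition hamming_graph :: "'a set \<Rightarrow> nat \<Rightarrow> 'a list pair_pre_digraph" where
  "hamming_graph \<Sigma> n =
    \<lparr> pverts = words \<Sigma> n,
      parcs = {(x, y). x \<in> words \<Sigma> n \<and> y \<in> words \<Sigma> n \<and> card (diff_positions x y) = 1} \<rparr>"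

lemma pair_graph_hamming_graph:
  assumes "finite \<Sigma>"
  shows "pair_graph (hamming_graph \<Sigma> n)"
proof -
  have fin: "finite (words \<Sigma> n)"
    using finite_lists_length_eq[OF assms, of n] by (simp add: words_def conj_commute)
  have arcs: "parcs (hamming_graph \<Sigma> n) \<subseteq> words \<Sigma> n \<times> words \<Sigma> n"
    by (auto simp: hamming_graph_def)
  have sym: "diff_positions x y = diff_positions y x"
    if "x \<in> words \<Sigma> n" "y \<in> words \<Sigma> n" for x y
    using that by (auto simp: diff_positions_def words_def)
  show ?thesis
  proof
    show "symmetric (with_proj (hamming_graph \<Sigma> n))"
      by (auto simp: symmetric_def hamming_graph_def sym intro!: symI)
    show "finite (parcs (hamming_graph \<Sigma> n))"
      using arcs fin by (meson finite_SigmaI finite_subset)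
  qed (auto simp: hamming_graph_def fin diff_positions_def)
qed

text \<open>A coloring with color set \<open>K\<close> is a \<open>k\<close>-coloring for \<open>k = card K\<close>.\<close>

definition coloring :: "'v pair_pre_digraph \<Rightarrow> 'c set \<Rightarrow> ('v \<Rightarrow> 'c) \<Rightarrow> bool" where
  "coloring G K c \<longleftrightarrow> finite K \<and> c ` pverts G = K"

text \<open>Matrices with rows and columns indexed by \<open>K\<close> are functions of which only the values
  on \<open>K \<times> K\<close> are relevant.\<close>

definition quotient_matrix ::
    "'v pair_pre_digraph \<Rightarrow> 'c set \<Rightarrow> ('v \<Rightarrow> 'c) \<Rightarrow> ('c \<Rightarrow> 'c \<Rightarrow> real) \<Rightarrow> bool" where
  "quotient_matrix G K c S \<longleftrightarrow>
    (\<forall>i\<in>K. \<forall>j\<in>K. \<forall>x\<in>pverts G. c x = i \<longrightarrow>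
      real (card {y \<in> pverts G. (x, y) \<in> parcs G \<and> c y = j}) = S i j)"

definition perfect_coloring ::
    "'v pair_pre_digraph \<Rightarrow> 'c set \<Rightarrow> ('c \<Rightarrow> 'c \<Rightarrow> real) \<Rightarrow> ('v \<Rightarrow> 'c) \<Rightarrow> bool" where
  "perfect_coloring G K S c \<longleftrightarrow> coloring G K c \<and> quotient_matrix G K c S"

definition essentially_depends :: "'a set \<Rightarrow> nat \<Rightarrow> ('a list \<Rightarrow> 'c) \<Rightarrow> nat \<Rightarrow> bool" where
  "essentially_depends \<Sigma> n f p \<longleftrightarrow>
    (\<exists>x \<in> pverts (hamming_graph \<Sigma> n). \<exists>y \<in> pverts (hamming_graph \<Sigma> n).
      diff_positions x y = {p} \<and> f x \<noteq> f y)"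

definition uniform_collection :: "'v pair_pre_digraph \<Rightarrow> nat \<Rightarrow> (nat \<Rightarrow> 'v \<Rightarrow> 'c) \<Rightarrow> bool" where
  "uniform_collection G M C \<longleftrightarrow>
    (\<forall>x \<in> pverts G. \<forall>y \<in> pverts G.
      {#C t x. t \<in># mset_set {..<M}#} = {#C t y. t \<in># mset_set {..<M}#})"

definition density :: "'v pair_pre_digraph \<Rightarrow> ('v \<Rightarrow> 'c) \<Rightarrow> 'c \<Rightarrow> real" where
  "density G c i = real (card {x \<in> pverts G. c x = i}) / real (card (pverts G))"

text \<open>\<open>\<rho>\<close> is, on \<open>K\<close>, the density vector of a perfect coloring of \<open>G\<close> with quotient matrix \<open>S\<close>.
  For a connected \<open>G\<close> such as a Hamming graph this determines \<open>\<rho>\<close> on \<open>K\<close>, because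
  \<open>\<rho> i * S i j = \<rho> j * S j i\<close>.\<close>

definition corresponding_density_vector ::
    "'v pair_pre_digraph \<Rightarrow> 'c set \<Rightarrow> ('c \<Rightarrow> 'c \<Rightarrow> real) \<Rightarrow> ('c \<Rightarrow> real) \<Rightarrow> bool" where
  "corresponding_density_vector G K S \<rho> \<longleftrightarrow>
    (\<exists>c. perfect_coloring G K S c \<and> (\<forall>i\<in>K. \<rho> i = density G c i))"

end

theory Submission
  imports Defs "HOL-Number_Theory.Cong"
begin

text \<open>Read a word of length \<open>q n + M\<close> as blocks \<open>x\<^sub>0, \<dots>, x\<^sub>q\<^sub>-\<^sub>1\<close> of length \<open>n\<close> followed by a tail \<open>y\<close> of
  length \<open>M\<close>, write \<open>E y = t q + k\<close> with \<open>k < q\<close>, and color the word by \<open>C\<^sub>t x\<^sub>k\<close>. Changes in the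
  block \<open>x\<^sub>k\<close> contribute \<open>S\<close> to the quotient matrix, and changes in the other blocks do not affect the
  color. By the form of \<open>T\<close>, changes in the tail reach every pair \<open>(t', k')\<close> with \<open>k' \<noteq> k\<close> exactly once;
  by uniformity each \<open>k'\<close> contributes \<open>M P\<close>. Shifting \<open>t\<close> cyclically modulo \<open>M\<close> yields a collection
  of \<open>M\<close> such colorings, which is again uniform with the same multiplicities, so the construction can
  be iterated.\<close>

section \<open>Words, arcs and connectedness of Hamming graphs\<close>

lemma diff_positions_update:
  assumes "p < length x" and "a \<noteq> x ! p"
  shows "diff_positions x (x[p := a]) = {p}"
  using assms by (auto simp: diff_positions_def nth_list_update)

lemma update_of_diff_positions:
  assumes "diff_positions x y = {p}" and "length x = length y"
  shows "y = x[p := y ! p]"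
proof (rule nth_equalityI)
  fix i assume "i < length y"
  moreover have "i < length x \<and> x ! i \<noteq> y ! i \<longleftrightarrow> i = p" for i
    using assms(1) by (auto simp: diff_positions_def set_eq_iff)
  ultimately show "y ! i = x[p := y ! p] ! i"
    using assms(2) by (metis nth_list_update)
qed (use assms(2) in simp)

lemma words_update:
  assumes "x \<in> words \<Sigma> n" and "a \<in> \<Sigma>"
  shows "x[p := a] \<in> words \<Sigma> n"
  using assms set_update_subset_insert[of x p a] by (auto simp: words_def)

lemma words_nth: "x \<in> words \<Sigma> n \<Longrightarrow> p < n \<Longrightarrow> x ! p \<in> \<Sigma>"
  by (auto simp: words_def)

lemma finite_words: "finite \<Sigma> \<Longrightarrow> finite (words \<Sigma> n)"
  using finite_lists_length_eq[of \<Sigma> n] by (simp add: words_def conj_commute)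

lemma hamming_arc_iff:
  "(x, y) \<in> parcs (hamming_graph \<Sigma> n) \<longleftrightarrow>
    x \<in> words \<Sigma> n \<and> y \<in> words \<Sigma> n \<and> card (diff_positions x y) = 1"
  by (simp add: hamming_graph_def)

lemma pverts_hamming [simp]: "pverts (hamming_graph \<Sigma> n) = words \<Sigma> n"
  by (simp add: hamming_graph_def)

lemma hamming_arc_sym:
  "(x, y) \<in> parcs (hamming_graph \<Sigma> n) \<longleftrightarrow> (y, x) \<in> parcs (hamming_graph \<Sigma> n)"
proof -
  have "diff_positions x y = diff_positions y x" if "x \<in> words \<Sigma> n" "y \<in> words \<Sigma> n"
    using that by (auto simp: diff_positions_def words_def)
  then show ?thesis by (auto simp: hamming_arc_iff)
qed

lemma hamming_arc_update:
  assumes "x \<in> words \<Sigma> n" and "p < n" and "a \<in> \<Sigma>" and "a \<noteq> x ! p"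
  shows "(x, x[p := a]) \<in> parcs (hamming_graph \<Sigma> n)"
  using assms words_update[OF assms(1,3)] diff_positions_update[of p x a]
  by (simp add: hamming_arc_iff words_def)

text \<open>A neighbor amounts to a choice of a position and of a new letter there. The predicate
  \<open>Q\<close> is left free so that it can later stand for any condition on the color of the
  neighbor.\<close>

lemma hamming_neighbors_eq:
  assumes "x \<in> words \<Sigma> n"
  shows "{y \<in> words \<Sigma> n. (x, y) \<in> parcs (hamming_graph \<Sigma> n) \<and> Q y} =
    (\<lambda>(p, a). x[p := a]) ` (SIGMA p:{..<n}. {a \<in> \<Sigma>. a \<noteq> x ! p \<and> Q (x[p := a])})"
    (is "?L = ?R")
proof
  show "?L \<subseteq> ?R"
  proof
    fix y assume y: "y \<in> ?L"
    then obtain p where p: "diff_positions x y = {p}"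
      by (auto simp: hamming_arc_iff card_1_singleton_iff)
    have len: "length x = n" "length y = n"
      using assms y by (auto simp: words_def)
    have eq: "y = x[p := y ! p]"
      using update_of_diff_positions[OF p] len by simp
    have "p < n" "x ! p \<noteq> y ! p"
      using p len by (auto simp: diff_positions_def)
    moreover have "y ! p \<in> \<Sigma>"
      using y \<open>p < n\<close> by (auto intro: words_nth)
    ultimately have "(p, y ! p) \<in> (SIGMA p:{..<n}. {a \<in> \<Sigma>. a \<noteq> x ! p \<and> Q (x[p := a])})"
      using y eq by auto
    then show "y \<in> ?R"
      using eq by (metis (no_types, lifting) case_prod_conv image_eqI)
  qed
  show "?R \<subseteq> ?L"
    using assms by (auto intro: words_update hamming_arc_update)
qed

text \<open>Position and new letter can be read off from the changed word, so the parametrization is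
  injective. The count then splits over positions, which lets each block and the tail of a word be
  treated separately.\<close>

lemma card_hamming_neighbors:
  assumes "finite \<Sigma>" and "x \<in> words \<Sigma> n"
  shows "card {y \<in> words \<Sigma> n. (x, y) \<in> parcs (hamming_graph \<Sigma> n) \<and> Q y} =
    (\<Sum>p<n. card {a \<in> \<Sigma>. a \<noteq> x ! p \<and> Q (x[p := a])})"
proof -
  have len: "length x = n"
    using assms by (simp add: words_def)
  have "inj_on (\<lambda>(p, a). x[p := a]) (SIGMA p:{..<n}. {a \<in> \<Sigma>. a \<noteq> x ! p \<and> Q (x[p := a])})"
  proof (rule inj_onI, clarsimp)
    fix p a p' a'
    assume *: "p < n" "p' < n" "a \<noteq> x ! p" "a' \<noteq> x ! p'" "x[p := a] = x[p' := a']"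
    then have "{p} = {p'}"
      using diff_positions_update len by metis
    then show "p = p' \<and> a = a'"
      using * len by (metis nth_list_update_eq singleton_inject)
  qed
  then show ?thesis
    using assms by (simp add: hamming_neighbors_eq card_image)
qed

text \<open>Connectedness, phrased without paths. In the induction the common first letter is kept
  while the rest is moved, which is the hypothesis for \<open>g\<close> composed with prepending
  that letter; then one arc changes the first letter.\<close>

lemma hamming_connected:
  assumes "\<And>x y. (x, y) \<in> parcs (hamming_graph \<Sigma> n) \<Longrightarrow> g x = g y"
    and "x \<in> words \<Sigma> n" and "y \<in> words \<Sigma> n"
  shows "g x = g y"
  using assms
proof (induction n arbitrary: g x y)
  case 0
  then show ?case by (simp add: words_def)
next
  case (Suc n)
  obtain a x' b y' where xy: "x = a # x'" "y = b # y'"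
    "x' \<in> words \<Sigma> n" "y' \<in> words \<Sigma> n" "a \<in> \<Sigma>" "b \<in> \<Sigma>"
    using Suc.prems(2,3) by (auto simp: words_def length_Suc_conv)
  have "g (a # u) = g (a # v)" if "(u, v) \<in> parcs (hamming_graph \<Sigma> n)" for u v
  proof -
    \<comment> \<open>Prepending a common letter shifts every differing position by one, so arcs
      stay arcs.\<close>
    have "diff_positions (a # u) (a # v) = Suc ` diff_positions u v"
      by (auto simp: diff_positions_def nth_Cons image_iff split: nat.splits)
        (metis Suc_less_eq gr0_implies_Suc not_gr_zero)
    then have "card (diff_positions (a # u) (a # v)) = card (diff_positions u v)"
      by (simp add: card_image)
    then show ?thesis
      using that \<open>a \<in> \<Sigma>\<close> by (intro Suc.prems(1)) (auto simp: hamming_arc_iff words_def)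
  qed
  then have "g (a # x') = g (a # y')"
    using Suc.IH[of "\<lambda>u. g (a # u)" x' y'] xy by blast
  also have "\<dots> = g (b # y')"
  proof (cases "a = b")
    case False
    then have "(a # y', (a # y')[0 := b]) \<in> parcs (hamming_graph \<Sigma> (Suc n))"
      using xy by (intro hamming_arc_update) (auto simp: words_def)
    then show ?thesis
      using Suc.prems(1) by fastforce
  qed simp
  finally show ?case
    using xy by simp
qed

section \<open>Perfect colorings and uniqueness of the density vector\<close>

lemma perfect_coloringD:
  assumes "perfect_coloring (hamming_graph \<Sigma> n) K S c"
  shows "finite K" and "c ` words \<Sigma> n = K"
    and "\<And>x j. x \<in> words \<Sigma> n \<Longrightarrow> j \<in> K \<Longrightarrow>
      real (card {y \<in> words \<Sigma> n. (x, y) \<in> parcs (hamming_graph \<Sigma> n) \<and> c y = j}) = S (c x) j"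
  using assms by (auto simp: perfect_coloring_def coloring_def quotient_matrix_def)

lemma perfect_coloring_cong:
  assumes "perfect_coloring G K S c" and "\<And>i j. i \<in> K \<Longrightarrow> j \<in> K \<Longrightarrow> S i j = S' i j"
  shows "perfect_coloring G K S' c"
  using assms by (simp add: perfect_coloring_def quotient_matrix_def)

text \<open>Both sides count the arcs from color \<open>i\<close> to color \<open>j\<close>.\<close>

lemma density_balance:
  assumes "finite \<Sigma>" and "perfect_coloring (hamming_graph \<Sigma> n) K S c" and "i \<in> K" and "j \<in> K"
  shows "density (hamming_graph \<Sigma> n) c i * S i j = density (hamming_graph \<Sigma> n) c j * S j i"
proof -
  let ?A = "\<lambda>i. {x \<in> words \<Sigma> n. c x = i}"
  let ?R = "parcs (hamming_graph \<Sigma> n)"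
  note fin = finite_words[OF assms(1), of n]
  have arcs: "real (card (?A i)) * S i j = real (card {(x, y) \<in> ?A i \<times> ?A j. (x, y) \<in> ?R})"
    if "i \<in> K" "j \<in> K" for i j
  proof -
    have "{(x, y) \<in> ?A i \<times> ?A j. (x, y) \<in> ?R} =
        (SIGMA x:?A i. {y \<in> words \<Sigma> n. (x, y) \<in> ?R \<and> c y = j})"
      by auto
    then have "real (card {(x, y) \<in> ?A i \<times> ?A j. (x, y) \<in> ?R}) =
        (\<Sum>x\<in>?A i. real (card {y \<in> words \<Sigma> n. (x, y) \<in> ?R \<and> c y = j}))"
      using fin by (simp only: card_SigmaI) simp
    also have "\<dots> = (\<Sum>x\<in>?A i. S i j)"
      using perfect_coloringD(3)[OF assms(2)] that by (intro sum.cong) auto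
    finally show ?thesis by simp
  qed
  have "{(x, y) \<in> ?A i \<times> ?A j. (x, y) \<in> ?R} = prod.swap ` {(x, y) \<in> ?A j \<times> ?A i. (x, y) \<in> ?R}"
    using hamming_arc_sym[of _ _ \<Sigma> n] by (force simp: image_iff)
  then have "card {(x, y) \<in> ?A i \<times> ?A j. (x, y) \<in> ?R} = card {(x, y) \<in> ?A j \<times> ?A i. (x, y) \<in> ?R}"
    by (simp add: card_image)
  then show ?thesis
    using arcs[of i j] arcs[of j i] assms by (simp add: density_def)
qed

lemma density_pos:
  assumes "finite \<Sigma>" and "perfect_coloring (hamming_graph \<Sigma> n) K S c" and "i \<in> K"
  shows "density (hamming_graph \<Sigma> n) c i > 0"
proof -
  obtain x where "x \<in> words \<Sigma> n" "c x = i"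
    using perfect_coloringD(2)[OF assms(2)] assms(3) by blast
  then have "{x \<in> words \<Sigma> n. c x = i} \<noteq> {}" "words \<Sigma> n \<noteq> {}"
    by blast+
  then show ?thesis
    using finite_words[OF assms(1), of n] by (simp add: density_def card_gt_0_iff)
qed

lemma sum_density:
  assumes "finite \<Sigma>" and "perfect_coloring (hamming_graph \<Sigma> n) K S c" and "K \<noteq> {}"
  shows "(\<Sum>i\<in>K. density (hamming_graph \<Sigma> n) c i) = 1"
proof -
  note fin = finite_words[OF assms(1), of n]
  have "words \<Sigma> n \<noteq> {}"
    using perfect_coloringD(2)[OF assms(2)] assms(3) by blast
  moreover have "(\<Sum>i\<in>K. card {x \<in> words \<Sigma> n. c x = i}) = card (words \<Sigma> n)"
    using sum.group[OF fin perfect_coloringD(1)[OF assms(2)], of c "\<lambda>_. 1::nat"]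
      perfect_coloringD(2)[OF assms(2)] by simp
  ultimately show ?thesis
    using fin by (simp add: density_def flip: sum_divide_distrib of_nat_sum)
qed

text \<open>By balance, the ratio of the two densities, read off at the color of a vertex, is
  constant along the arcs.\<close>

lemma density_unique:
  assumes \<Sigma>: "finite \<Sigma>"
    and c: "perfect_coloring (hamming_graph \<Sigma> n) K S c"
    and d: "perfect_coloring (hamming_graph \<Sigma> n) K S d"
    and i: "i \<in> K"
  shows "density (hamming_graph \<Sigma> n) c i = density (hamming_graph \<Sigma> n) d i"
proof -
  let ?c = "density (hamming_graph \<Sigma> n) c" and ?d = "density (hamming_graph \<Sigma> n) d"
  define f where "f j = ?c j / ?d j" for j
  have edge: "f (c x) = f (c y)" if arc: "(x, y) \<in> parcs (hamming_graph \<Sigma> n)" for x y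
  proof -
    have xy: "x \<in> words \<Sigma> n" "y \<in> words \<Sigma> n"
      using arc by (auto simp: hamming_arc_iff)
    then have K: "c x \<in> K" "c y \<in> K"
      using perfect_coloringD(2)[OF c] by auto
    \<comment> \<open>The matrix entries for the end colors of an arc are positive in both
      directions, so they can be cancelled when the balance equations for \<open>c\<close> and
      \<open>d\<close> are compared.\<close>
    have "S (c x) (c y) > 0" if "(x, y) \<in> parcs (hamming_graph \<Sigma> n)" "x \<in> words \<Sigma> n"
      "y \<in> words \<Sigma> n" "c y \<in> K" for x y
    proof -
      have "y \<in> {z \<in> words \<Sigma> n. (x, z) \<in> parcs (hamming_graph \<Sigma> n) \<and> c z = c y}"
        using that by simp
      then have "card {z \<in> words \<Sigma> n. (x, z) \<in> parcs (hamming_graph \<Sigma> n) \<and> c z = c y} > 0"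
        using finite_words[OF \<Sigma>, of n] by (auto simp: card_gt_0_iff)
      then show ?thesis
        using perfect_coloringD(3)[OF c that(2,4)] by simp
    qed
    then have "S (c x) (c y) > 0" "S (c y) (c x) > 0"
      using arc hamming_arc_sym[of x y \<Sigma> n] xy K by auto
    moreover have "?d (c x) > 0" "?d (c y) > 0"
      using density_pos[OF \<Sigma> d] K by auto
    moreover note density_balance[OF \<Sigma> c K] density_balance[OF \<Sigma> d K]
    ultimately show ?thesis
      unfolding f_def by (simp add: field_simps) (smt (verit, ccfv_SIG) mult.assoc mult.commute mult_cancel_left)
  qed
  have const: "f j = f i" if "j \<in> K" for j
  proof -
    obtain x y where "x \<in> words \<Sigma> n" "y \<in> words \<Sigma> n" "j = c x" "i = c y"
      using perfect_coloringD(2)[OF c] \<open>j \<in> K\<close> i by blast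
    then show ?thesis
      using hamming_connected[of \<Sigma> n "\<lambda>x. f (c x)" x y] edge by simp
  qed
  have eq: "?c j = f i * ?d j" if "j \<in> K" for j
    using const[OF that] density_pos[OF \<Sigma> d that] by (simp add: f_def field_simps)
  \<comment> \<open>Both density vectors sum to 1, which forces the constant ratio to be 1.\<close>
  have "1 = (\<Sum>j\<in>K. f i * ?d j)"
    using sum_density[OF \<Sigma> c] i eq by (metis (no_types, lifting) empty_iff sum.cong)
  also have "\<dots> = f i"
    using sum_density[OF \<Sigma> d] i by (auto simp flip: sum_distrib_left)
  finally show ?thesis
    using eq[OF i] by simp
qed

section \<open>Cutting a word into blocks and a tail\<close>

definition block :: "nat \<Rightarrow> nat \<Rightarrow> 'a list \<Rightarrow> 'a list" where
  "block n k w = take n (drop (k * n) w)"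

text \<open>The inverse of the cutting. It supplies words with prescribed blocks and tail, as needed
  for surjectivity and for essential dependence.\<close>

definition join_blocks :: "nat \<Rightarrow> nat \<Rightarrow> (nat \<Rightarrow> 'a list) \<Rightarrow> 'a list \<Rightarrow> 'a list" where
  "join_blocks q n xs y =
    map (\<lambda>p. if p < q * n then xs (p div n) ! (p mod n) else y ! (p - q * n)) [0..<q * n + length y]"

lemma block_index: "k < q \<Longrightarrow> p < n \<Longrightarrow> k * n + p < q * (n::nat)"
  using mult_le_mono1[of "Suc k" q n] by simp

lemma block_mem:
  assumes "w \<in> words \<Sigma> (q * n + M)" and "k < q"
  shows "block n k w \<in> words \<Sigma> n"
proof -
  have "k * n + n \<le> q * n"
    using assms(2) mult_le_mono1[of "Suc k" q n] by simp
  then show ?thesis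
    using assms(1) set_take_subset[of n "drop (k * n) w"] set_drop_subset[of "k * n" w]
    by (auto simp: words_def block_def)
qed

lemma tail_mem: "w \<in> words \<Sigma> (q * n + M) \<Longrightarrow> drop (q * n) w \<in> words \<Sigma> M"
  using set_drop_subset[of "q * n" w] by (auto simp: words_def)

lemma block_nth:
  assumes "length w = q * n + M" and "k < q" and "p < n"
  shows "block n k w ! p = w ! (k * n + p)"
  using assms block_index[OF assms(2,3)] by (simp add: block_def)

lemma length_block:
  assumes "length w = q * n + M" and "k < q"
  shows "length (block n k w) = n"
  using assms mult_le_mono1[of "Suc k" q n] by (simp add: block_def)

lemma block_update_block:
  assumes "length w = q * n + M" and "k < q" and "k' < q" and "p < n"
  shows "block n k (w[k' * n + p := a]) = (if k = k' then (block n k w)[p := a] else block n k w)"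
proof (rule nth_equalityI)
  show "length (block n k (w[k' * n + p := a])) =
      length (if k = k' then (block n k w)[p := a] else block n k w)"
    using assms by (simp add: length_block)
  fix i assume "i < length (block n k (w[k' * n + p := a]))"
  then have i: "i < n"
    using assms by (simp add: length_block)
  \<comment> \<open>Division with remainder by \<open>n\<close> recovers the block number and the
    offset within the block, so an update touches exactly one block.\<close>
  have *: "k' * n + p = k * n + i \<longleftrightarrow> k = k' \<and> p = i"
  proof
    assume "k' * n + p = k * n + i"
    then have "(k' * n + p) div n = (k * n + i) div n" "(k' * n + p) mod n = (k * n + i) mod n"
      by simp_all
    then show "k = k' \<and> p = i"
      using i assms(4) by simp
  qed simp
  show "block n k (w[k' * n + p := a]) ! i =
      (if k = k' then (block n k w)[p := a] else block n k w) ! i"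
    using assms i * block_index[of k' q p n]
    by (auto simp: block_nth nth_list_update length_block)
qed

lemma block_update_tail:
  assumes "length w = q * n + M" and "k < q"
  shows "block n k (w[q * n + p := a]) = block n k w"
proof (rule nth_equalityI)
  fix i assume "i < length (block n k (w[q * n + p := a]))"
  then have "i < n"
    using assms by (simp add: length_block)
  then show "block n k (w[q * n + p := a]) ! i = block n k w ! i"
    using assms block_index[OF assms(2), of i n] by (simp add: block_nth)
qed (use assms in \<open>simp add: length_block\<close>)

lemma tail_update_block:
  assumes "k < q" and "p < n"
  shows "drop (q * n) (w[k * n + p := a]) = drop (q * n) w"
  using block_index[OF assms] by simp

lemma tail_update_tail: "drop m (w[m + p := a]) = (drop m w)[p := a]"
  by (simp add: drop_update_swap)

lemma join_blocks_mem:
  assumes "\<And>k. k < q \<Longrightarrow> xs k \<in> words \<Sigma> n" and "y \<in> words \<Sigma> M"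
  shows "join_blocks q n xs y \<in> words \<Sigma> (q * n + M)"
proof -
  have "xs (p div n) ! (p mod n) \<in> \<Sigma>" if "p < q * n" for p
  proof (rule words_nth[OF assms(1)])
    show "p div n < q"
      using that by (simp add: less_mult_imp_div_less)
    show "p mod n < n"
      using that by (cases n) auto
  qed
  moreover have "y ! (p - q * n) \<in> \<Sigma>" if "\<not> p < q * n" "p < q * n + M" for p
    using that by (intro words_nth[OF assms(2)]) auto
  ultimately show ?thesis
    using assms(2) by (auto simp: words_def join_blocks_def)
qed

lemma block_join_blocks:
  assumes "k < q" and "length (xs k) = n"
  shows "block n k (join_blocks q n xs y) = xs k"
proof -
  have len: "length (join_blocks q n xs y) = q * n + length y"
    by (simp add: join_blocks_def)
  show ?thesis
  proof (rule nth_equalityI)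
    show "length (block n k (join_blocks q n xs y)) = length (xs k)"
      using length_block[OF len assms(1)] assms(2) by simp
    fix i assume "i < length (block n k (join_blocks q n xs y))"
    then have "i < n"
      using length_block[OF len assms(1)] by simp
    then show "block n k (join_blocks q n xs y) ! i = xs k ! i"
      using block_index[OF assms(1), of i n] block_nth[OF len assms(1)]
      by (simp add: join_blocks_def)
  qed
qed

lemma tail_join_blocks: "drop (q * n) (join_blocks q n xs y) = y"
  by (intro nth_equalityI) (auto simp: join_blocks_def)

section \<open>Counting with quotients, remainders and cyclic shifts\<close>

text \<open>Division by \<open>q\<close> identifies the colors of \<open>E\<close> with pairs of a
  block number (remainder) and a member of the collection (quotient). The count is grouped by block
  number.\<close>

lemma card_div_mod_pairs:
  fixes k q M :: nat
  assumes "q > 0" and "k < q"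
  shows "card {l. l < M * q \<and> l mod q \<noteq> k \<and> Q (l div q) (l mod q)} =
    (\<Sum>k'\<in>{..<q} - {k}. card {t. t < M \<and> Q t k'})"
proof -
  have "bij_betw (\<lambda>l. (l mod q, l div q)) {l. l < M * q \<and> l mod q \<noteq> k \<and> Q (l div q) (l mod q)}
      (SIGMA k':{..<q} - {k}. {t. t < M \<and> Q t k'})"
    by (rule bij_betw_byWitness[where f' = "\<lambda>(k', t). t * q + k'"])
      (use assms in \<open>auto simp: less_mult_imp_div_less intro: block_index\<close>)
  from bij_betw_same_card[OF this] show ?thesis
    by simp
qed

text \<open>A cyclic shift is an injective map of a finite set into itself, hence a
  permutation.\<close>

lemma card_shift_mod:
  fixes M s :: nat
  shows "card {t. t < M \<and> Q ((t + s) mod M)} = card {t. t < M \<and> Q t}"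
proof (cases "M = 0")
  case False
  have inj: "inj_on (\<lambda>t. (t + s) mod M) {..<M}"
  proof (rule inj_onI)
    fix t u assume "t \<in> {..<M}" "u \<in> {..<M}" "(t + s) mod M = (u + s) mod M"
    then show "t = u"
      by (metis cong_add_rcancel_nat cong_def lessThan_iff mod_less)
  qed
  have onto: "(\<lambda>t. (t + s) mod M) ` {..<M} = {..<M}"
    using inj False by (intro endo_inj_surj) auto
  have "{t. t < M \<and> Q t} = {t \<in> (\<lambda>t. (t + s) mod M) ` {..<M}. Q t}"
    by (simp add: onto)
  also have "\<dots> = (\<lambda>t. (t + s) mod M) ` {t. t < M \<and> Q ((t + s) mod M)}"
    by blast
  also have "card \<dots> = card {t. t < M \<and> Q ((t + s) mod M)}"
    by (intro card_image inj_on_subset[OF inj]) auto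
  finally show ?thesis ..
qed simp

lemma sum_lessThan_add:
  fixes f :: "nat \<Rightarrow> 'a::comm_monoid_add"
  shows "(\<Sum>p<m + n. f p) = (\<Sum>p<m. f p) + (\<Sum>p<n. f (m + p))"
  by (induction n) (simp_all add: add.assoc)

section \<open>The construction by a selector coloring, and its iteration\<close>

text \<open>Only the selector \<open>E\<close> and its parameters are fixed here. The length
  \<open>n\<close> and the collection \<open>C\<close> change at each iteration, so they remain
  arguments.\<close>

locale selector_coloring =
  fixes q M :: nat and \<Sigma> :: "'a set" and E :: "'a list \<Rightarrow> nat" and T :: "nat \<Rightarrow> nat \<Rightarrow> real"
  assumes q: "q \<ge> 2" and M: "M > 0" and \<Sigma>: "finite \<Sigma>" "card \<Sigma> = q"
    and T: "\<forall>j<M*q. \<forall>l<M*q. T j l = (if j mod q = l mod q then 0 else 1)"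
    and E: "perfect_coloring (hamming_graph \<Sigma> M) {..<M*q} T E"
begin

lemma E_less: "y \<in> words \<Sigma> M \<Longrightarrow> E y < M * q"
  using perfect_coloringD(2)[OF E] by auto

lemma E_onto:
  assumes "l < M * q"
  obtains y where "y \<in> words \<Sigma> M" and "E y = l"
  using perfect_coloringD(2)[OF E] assms by (metis imageE lessThan_iff)

text \<open>By the form of \<open>T\<close>, \<open>E\<close> maps the neighbors of \<open>y\<close>
  bijectively onto the colors in the other residue classes modulo \<open>q\<close>. Counting
  neighbors by color is therefore counting colors.\<close>

lemma E_neighbors:
  assumes y: "y \<in> words \<Sigma> M"
  shows "card {z \<in> words \<Sigma> M. (y, z) \<in> parcs (hamming_graph \<Sigma> M) \<and> Q (E z)} =
    card {l. l < M * q \<and> l mod q \<noteq> E y mod q \<and> Q l}"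
proof -
  let ?B = "\<lambda>l. {z \<in> words \<Sigma> M. (y, z) \<in> parcs (hamming_graph \<Sigma> M) \<and> E z = l}"
  have card_B: "card (?B l) = (if l mod q = E y mod q then 0 else 1)" if "l < M * q" for l
  proof -
    have "real (card (?B l)) = (if l mod q = E y mod q then 0 else 1)"
      using perfect_coloringD(3)[OF E y, of l] T E_less[OF y] that by auto
    then show ?thesis by (simp split: if_splits)
  qed
  have "{z \<in> words \<Sigma> M. (y, z) \<in> parcs (hamming_graph \<Sigma> M) \<and> Q (E z)} =
      (\<Union>l\<in>{l. l < M * q \<and> Q l}. ?B l)"
    using E_less by auto
  also have "card \<dots> = (\<Sum>l\<in>{l. l < M * q \<and> Q l}. card (?B l))"
    using finite_words[OF \<Sigma>(1), of M] by (intro card_UN_disjoint) auto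
  also have "\<dots> = (\<Sum>l\<in>{l. l < M * q \<and> Q l}. if l mod q \<noteq> E y mod q then 1 else 0)"
    using card_B by (intro sum.cong) auto
  also have "\<dots> = card {l. l < M * q \<and> l mod q \<noteq> E y mod q \<and> Q l}"
    by (auto simp: sum.If_cases intro!: arg_cong[where f = card])
  finally show ?thesis .
qed

text \<open>These are the zero entries of \<open>T\<close>. Consequently every change of a tail
  letter switches to a different block.\<close>

lemma E_arc_mod:
  assumes arc: "(y, z) \<in> parcs (hamming_graph \<Sigma> M)"
  shows "E y mod q \<noteq> E z mod q"
proof
  assume "E y mod q = E z mod q"
  have yz: "y \<in> words \<Sigma> M" "z \<in> words \<Sigma> M"
    using arc by (auto simp: hamming_arc_iff)
  have "card {u \<in> words \<Sigma> M. (y, u) \<in> parcs (hamming_graph \<Sigma> M) \<and> E u = E z} =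
      card {l. l < M * q \<and> l mod q \<noteq> E y mod q \<and> l = E z}"
    by (rule E_neighbors[OF yz(1)])
  also have "\<dots> = 0"
    using \<open>E y mod q = E z mod q\<close> by (auto simp: card_eq_0_iff)
  finally have "{u \<in> words \<Sigma> M. (y, u) \<in> parcs (hamming_graph \<Sigma> M) \<and> E u = E z} = {}"
    using finite_words[OF \<Sigma>(1), of M] by (subst (asm) card_0_eq) auto
  then show False
    using arc yz by blast
qed

text \<open>The shift \<open>s\<close> numbers the members of the new collection: for a fixed word
  it changes which member of \<open>C\<close> is applied, but not which block is read.\<close>

definition lift :: "nat \<Rightarrow> (nat \<Rightarrow> 'a list \<Rightarrow> 'c) \<Rightarrow> nat \<Rightarrow> 'a list \<Rightarrow> 'c" where
  "lift n C s w =
    (let e = E (drop (q * n) w) in C ((e div q + s) mod M) (block n (e mod q) w))"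

lemma lift_join_blocks:
  assumes "\<And>k. k < q \<Longrightarrow> xs k \<in> words \<Sigma> n"
  shows "lift n C s (join_blocks q n xs y) = C ((E y div q + s) mod M) (xs (E y mod q))"
  using assms[of "E y mod q"] q
  by (simp add: lift_def tail_join_blocks block_join_blocks words_def Let_def)

text \<open>For a fixed word the block being read is fixed, and as \<open>s\<close> varies every
  member of \<open>C\<close> is applied to it exactly once. So the multiplicity of each color is
  inherited.\<close>

lemma lift_count:
  assumes "w \<in> words \<Sigma> (q * n + M)"
    and "\<And>x. x \<in> words \<Sigma> n \<Longrightarrow> card {t. t < M \<and> C t x = j} = m"
  shows "card {s. s < M \<and> lift n C s w = j} = m"
proof -
  define e where "e = E (drop (q * n) w)"
  have "card {s. s < M \<and> lift n C s w = j} =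
      card {s. s < M \<and> C ((s + e div q) mod M) (block n (e mod q) w) = j}"
    by (simp add: lift_def Let_def add.commute flip: e_def)
  also have "\<dots> = card {t. t < M \<and> C t (block n (e mod q) w) = j}"
    by (rule card_shift_mod)
  also have "\<dots> = m"
    using q by (intro assms(2) block_mem[OF assms(1)]) simp
  finally show ?thesis .
qed

lemma lift_onto:
  assumes C: "\<And>t. t < M \<Longrightarrow> C t ` words \<Sigma> n = K"
  shows "lift n C s ` words \<Sigma> (q * n + M) = K"
proof
  show "lift n C s ` words \<Sigma> (q * n + M) \<subseteq> K"
  proof
    fix j assume "j \<in> lift n C s ` words \<Sigma> (q * n + M)"
    then obtain w where w: "w \<in> words \<Sigma> (q * n + M)" "j = lift n C s w"
      by blast
    let ?e = "E (drop (q * n) w)"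
    have "C ((?e div q + s) mod M) (block n (?e mod q) w) \<in> C ((?e div q + s) mod M) ` words \<Sigma> n"
      using q by (intro imageI block_mem[OF w(1)]) simp
    then show "j \<in> K"
      using C[of "(?e div q + s) mod M"] M w(2) by (simp add: lift_def Let_def)
  qed
  show "K \<subseteq> lift n C s ` words \<Sigma> (q * n + M)"
  proof
    fix j assume "j \<in> K"
    \<comment> \<open>With \<open>E y = 0\<close> the member applied is \<open>s mod M\<close>. All
      blocks are taken equal to a word to which this member gives color \<open>j\<close>.\<close>
    obtain y where y: "y \<in> words \<Sigma> M" "E y = 0"
      using E_onto[of 0] M q by auto
    obtain x where x: "x \<in> words \<Sigma> n" "C (s mod M) x = j"
      using C[of "s mod M"] M \<open>j \<in> K\<close> by (metis imageE mod_less_divisor)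
    have "lift n C s (join_blocks q n (\<lambda>_. x) y) = j"
      using x y by (simp add: lift_join_blocks)
    then show "j \<in> lift n C s ` words \<Sigma> (q * n + M)"
      using join_blocks_mem[of q "\<lambda>_. x" \<Sigma> n y M] x y by blast
  qed
qed

text \<open>The neighbors are sorted by the position changed. The selected block gives the entry of
  \<open>S\<close>; each of the \<open>q - 1\<close> other blocks gives \<open>(q - 1) * n\<close>
  neighbors of unchanged color; each of the \<open>q - 1\<close> residues reachable from the tail
  gives \<open>m\<close>.\<close>

lemma lift_neighbors:
  assumes w: "w \<in> words \<Sigma> (q * n + M)" and j: "j \<in> K"
    and C: "\<And>t. t < M \<Longrightarrow> perfect_coloring (hamming_graph \<Sigma> n) K S (C t)"
    and m: "\<And>x. x \<in> words \<Sigma> n \<Longrightarrow> card {t. t < M \<and> C t x = j} = m"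
  shows "real (card {v \<in> words \<Sigma> (q * n + M).
      (w, v) \<in> parcs (hamming_graph \<Sigma> (q * n + M)) \<and> lift n C s v = j}) =
    S (lift n C s w) j + (if lift n C s w = j then (real q - 1)\<^sup>2 * real n else 0) + (real q - 1) * real m"
proof -
  define N where "N = q * n + M"
  define y where "y = drop (q * n) w"
  define k where "k = E y mod q"
  define t where "t = (E y div q + s) mod M"
  let ?cnt = "\<lambda>p. card {a \<in> \<Sigma>. a \<noteq> w ! p \<and> lift n C s (w[p := a]) = j}"
  have len: "length w = q * n + M"
    using w by (simp add: words_def)
  have y: "y \<in> words \<Sigma> M"
    using tail_mem[OF w] by (simp add: y_def)
  have k: "k < q" and t: "t < M"
    using q M by (auto simp: k_def t_def)
  have lift_w: "lift n C s w = C t (block n k w)"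
    by (simp add: lift_def k_def t_def y_def Let_def)
  have lift_block: "lift n C s (w[k' * n + p := a]) =
      C t (if k' = k then (block n k w)[p := a] else block n k w)" if "k' < q" "p < n" for k' p a
    using that k by (simp add: lift_def tail_update_block block_update_block[OF len] Let_def
        flip: y_def k_def t_def)
  have lift_tail: "lift n C s (w[q * n + p := a]) =
      C ((E (y[p := a]) div q + s) mod M) (block n (E (y[p := a]) mod q) w)" for p a
    using q by (simp add: lift_def tail_update_tail block_update_tail[OF len] Let_def flip: y_def)
  have own: "real (\<Sum>p<n. ?cnt (k * n + p)) = S (lift n C s w) j"
  proof -
    have "(\<Sum>p<n. ?cnt (k * n + p)) =
        (\<Sum>p<n. card {a \<in> \<Sigma>. a \<noteq> block n k w ! p \<and> C t ((block n k w)[p := a]) = j})"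
      using k lift_block block_nth[OF len] by (intro sum.cong) simp_all
    also have "\<dots> = card {v \<in> words \<Sigma> n. (block n k w, v) \<in> parcs (hamming_graph \<Sigma> n) \<and> C t v = j}"
      by (simp add: card_hamming_neighbors[OF \<Sigma>(1) block_mem[OF w k]])
    finally show ?thesis
      using perfect_coloringD(3)[OF C[OF t] block_mem[OF w k] j] by (simp add: lift_w)
  qed
  have other: "(\<Sum>p<n. ?cnt (k' * n + p)) = (if lift n C s w = j then (q - 1) * n else 0)"
    if "k' < q" "k' \<noteq> k" for k'
  proof -
    have "?cnt (k' * n + p) = (if lift n C s w = j then q - 1 else 0)" if "p < n" for p
    proof -
      have "w ! (k' * n + p) \<in> \<Sigma>"
        using block_index[OF \<open>k' < q\<close> that] by (intro words_nth[OF w]) simp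
      moreover have "{a \<in> \<Sigma>. a \<noteq> w ! (k' * n + p)} = \<Sigma> - {w ! (k' * n + p)}"
        by auto
      ultimately show ?thesis
        using \<Sigma> lift_block[OF \<open>k' < q\<close> that] \<open>k' \<noteq> k\<close> by (simp add: lift_w)
    qed
    then show ?thesis by simp
  qed
  have tail: "(\<Sum>p<M. ?cnt (q * n + p)) = (q - 1) * m"
  proof -
    let ?Q = "\<lambda>u k'. C ((u + s) mod M) (block n k' w) = j"
    have "(\<Sum>p<M. ?cnt (q * n + p)) =
        (\<Sum>p<M. card {a \<in> \<Sigma>. a \<noteq> y ! p \<and> ?Q (E (y[p := a]) div q) (E (y[p := a]) mod q)})"
      using len by (simp add: lift_tail y_def)
    also have "\<dots> = card {z \<in> words \<Sigma> M. (y, z) \<in> parcs (hamming_graph \<Sigma> M) \<and>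
        ?Q (E z div q) (E z mod q)}"
      by (simp add: card_hamming_neighbors[OF \<Sigma>(1) y])
    also have "\<dots> = card {l. l < M * q \<and> l mod q \<noteq> k \<and> ?Q (l div q) (l mod q)}"
      unfolding k_def by (rule E_neighbors[OF y])
    also have "\<dots> = (\<Sum>k'\<in>{..<q} - {k}. card {u. u < M \<and> ?Q u k'})"
      using k by (intro card_div_mod_pairs) auto
    \<comment> \<open>For fixed \<open>k'\<close> the vertex \<open>block n k' w\<close> is fixed
      while the shifted index runs through the whole collection, so \<open>j\<close> occurs
      \<open>m\<close> times.\<close>
    also have "\<dots> = (\<Sum>k'\<in>{..<q} - {k}. m)"
    proof (rule sum.cong)
      fix k' assume "k' \<in> {..<q} - {k}"
      then show "card {u. u < M \<and> ?Q u k'} = m"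
        using card_shift_mod[of M "\<lambda>u. C u (block n k' w) = j" s] m block_mem[OF w] by simp
    qed simp
    also have "\<dots> = (q - 1) * m"
      using k by simp
    finally show ?thesis .
  qed
  have "card {v \<in> words \<Sigma> N. (w, v) \<in> parcs (hamming_graph \<Sigma> N) \<and> lift n C s v = j} =
      (\<Sum>p<N. ?cnt p)"
    using w by (simp add: card_hamming_neighbors[OF \<Sigma>(1)] N_def)
  also have "\<dots> = (\<Sum>p<q * n. ?cnt p) + (\<Sum>p<M. ?cnt (q * n + p))"
    unfolding N_def by (rule sum_lessThan_add)
  also have "(\<Sum>p<q * n. ?cnt p) = (\<Sum>k'<q. \<Sum>p<n. ?cnt (k' * n + p))"
    using sum.nat_group[of ?cnt n q] by (simp add: sum.atLeastLessThan_shift_0 atLeast0LessThan)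
  also have "\<dots> = (\<Sum>p<n. ?cnt (k * n + p)) + (\<Sum>k'\<in>{..<q} - {k}. \<Sum>p<n. ?cnt (k' * n + p))"
    using k by (intro sum.remove) auto
  also have "(\<Sum>k'\<in>{..<q} - {k}. \<Sum>p<n. ?cnt (k' * n + p)) =
      (q - 1) * (if lift n C s w = j then (q - 1) * n else 0)"
    using other k by simp
  finally show ?thesis
    using q unfolding tail by (simp only: of_nat_add own N_def) (simp add: of_nat_diff power2_eq_square)
qed

text \<open>A position inside a block inherits dependence from \<open>C 0\<close>. For a tail
  position, changing the letter switches blocks, and the two blocks can be filled to produce
  different colors.\<close>

lemma lift_essentially_depends:
  assumes C: "\<And>t. t < M \<Longrightarrow> C t ` words \<Sigma> n = K"
    and K: "j0 \<in> K" "j1 \<in> K" "j0 \<noteq> j1"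
    and dep: "\<And>p. p < n \<Longrightarrow> essentially_depends \<Sigma> n (C 0) p"
    and p: "p < q * n + M"
  shows "essentially_depends \<Sigma> (q * n + M) (lift n C 0) p"
proof (cases "p < q * n")
  case True
  define k i where "k = p div n" and "i = p mod n"
  have k: "k < q" and i: "i < n" and p_eq: "p = k * n + i"
    using True by (auto simp: k_def i_def less_mult_imp_div_less intro!: mod_less_divisor intro: ccontr)
  obtain x x' where x: "x \<in> words \<Sigma> n" "x' \<in> words \<Sigma> n" "diff_positions x x' = {i}" "C 0 x \<noteq> C 0 x'"
    using dep[OF i] by (auto simp: essentially_depends_def)
  \<comment> \<open>Since \<open>k < q\<close>, the color \<open>k\<close> has quotient 0 and
    remainder \<open>k\<close>: this tail applies \<open>C 0\<close> to the very block containing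
    \<open>p\<close>.\<close>
  obtain y where y: "y \<in> words \<Sigma> M" "E y = k"
    using E_onto[of k] k M by (metis Suc_leI less_le_trans mult.commute mult.right_neutral mult_le_mono2 One_nat_def)
  define w where "w = join_blocks q n (\<lambda>_. x) y"
  define w' where "w' = w[p := x' ! i]"
  have w: "w \<in> words \<Sigma> (q * n + M)"
    using x y by (auto simp: w_def intro: join_blocks_mem)
  then have len: "length w = q * n + M"
    by (simp add: words_def)
  have lens: "length x = n" "length x' = n"
    using x by (auto simp: words_def)
  have bw: "block n k w = x" and tw: "drop (q * n) w = y"
    using k lens by (simp_all add: w_def block_join_blocks tail_join_blocks)
  have "w' \<in> words \<Sigma> (q * n + M)"
    using w x i by (auto simp: w'_def intro!: words_update words_nth)
  moreover have "diff_positions w w' = {p}"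
  proof -
    have "w ! p = x ! i"
      using block_nth[OF len k i] by (simp add: bw p_eq)
    moreover have "x ! i \<noteq> x' ! i"
      using x(3) unfolding diff_positions_def by blast
    ultimately show ?thesis
      using p len unfolding w'_def by (intro diff_positions_update) auto
  qed
  moreover have "block n k w' = x'"
    using update_of_diff_positions[OF x(3)] lens block_update_block[OF len k k i]
    by (simp add: w'_def p_eq bw)
  then have "lift n C 0 w' = C 0 x'"
    using k by (simp add: lift_def Let_def w'_def p_eq tail_update_block[OF k i] tw y)
  moreover have "lift n C 0 w = C 0 x"
    using k by (simp add: lift_def Let_def tw y bw)
  ultimately show ?thesis
    using w x(4) unfolding essentially_depends_def pverts_hamming by metis
next
  case False
  define i where "i = p - q * n"
  have i: "i < M" and p_eq: "p = q * n + i"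
    using False p by (auto simp: i_def)
  obtain y where y: "y \<in> words \<Sigma> M"
    using E_onto[of 0] M q by auto
  have "\<Sigma> - {y ! i} \<noteq> {}"
  proof
    assume "\<Sigma> - {y ! i} = {}"
    then have "card \<Sigma> \<le> card {y ! i}"
      by (intro card_mono) auto
    then show False
      using \<Sigma> q by simp
  qed
  then obtain a where a: "a \<in> \<Sigma>" "a \<noteq> y ! i"
    by blast
  define y' where "y' = y[i := a]"
  have mods: "E y mod q \<noteq> E y' mod q"
    using E_arc_mod hamming_arc_update[OF y i a] by (simp add: y'_def)
  obtain x where x: "x \<in> words \<Sigma> n" "C (E y div q mod M) x = j0"
    using C[of "E y div q mod M"] M K(1) by (metis imageE mod_less_divisor)
  obtain x' where x': "x' \<in> words \<Sigma> n" "C (E y' div q mod M) x' = j1"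
    using C[of "E y' div q mod M"] M K(2) by (metis imageE mod_less_divisor)
  \<comment> \<open>The block selected by \<open>y\<close> gets color \<open>j0\<close>. The block
    selected by \<open>y'\<close> is a different one, so it can independently be given color
    \<open>j1\<close>.\<close>
  define xs where "xs k = (if k = E y mod q then x else x')" for k
  define w where "w = join_blocks q n xs y"
  define w' where "w' = w[p := a]"
  have xs: "xs k \<in> words \<Sigma> n" for k
    using x x' by (simp add: xs_def)
  have w: "w \<in> words \<Sigma> (q * n + M)"
    using xs y by (auto simp: w_def intro: join_blocks_mem)
  then have len: "length w = q * n + M"
    by (simp add: words_def)
  have tw: "drop (q * n) w = y"
    by (simp add: w_def tail_join_blocks)
  have w': "w' \<in> words \<Sigma> (q * n + M)"
    using w a by (auto simp: w'_def intro!: words_update)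
  have "w ! p = y ! i"
    using tw len by (auto simp: p_eq)
  then have "diff_positions w w' = {p}"
    using p len a unfolding w'_def by (intro diff_positions_update) auto
  moreover have "lift n C 0 w = j0"
    using xs x by (simp add: w_def lift_join_blocks xs_def)
  moreover have "lift n C 0 w' = j1"
  proof -
    have "drop (q * n) w' = y'"
      by (simp add: w'_def p_eq tail_update_tail tw y'_def)
    moreover have "block n (E y' mod q) w' = xs (E y' mod q)"
    proof -
      have "block n (E y' mod q) w' = block n (E y' mod q) w"
        using q by (simp add: w'_def p_eq block_update_tail[OF len])
      also have "\<dots> = xs (E y' mod q)"
        using q xs[of "E y' mod q"] by (simp add: w_def block_join_blocks words_def)
      finally show ?thesis .
    qed
    ultimately show ?thesis
      using x' mods by (simp add: lift_def Let_def xs_def)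
  qed
  ultimately show ?thesis
    using w w' K(3) unfolding essentially_depends_def pverts_hamming by metis
qed

text \<open>The induction must carry a whole collection with unchanged multiplicities
  \<open>m\<close>, because the next step uses all members. Essential dependence is carried for
  member 0 alone, which suffices for the next step. In the application \<open>m l\<close> is the
  entry of \<open>M P\<close> in column \<open>l\<close>.\<close>

lemma iterated_lift:
  fixes C :: "nat \<Rightarrow> 'a list \<Rightarrow> 'c"
  assumes C: "\<And>t. t < M \<Longrightarrow> perfect_coloring (hamming_graph \<Sigma> n) K S (C t)"
    and m: "\<And>x j. x \<in> words \<Sigma> n \<Longrightarrow> j \<in> K \<Longrightarrow> card {t. t < M \<and> C t x = j} = m j"
    and dep: "\<And>p. p < n \<Longrightarrow> essentially_depends \<Sigma> n (C 0) p"
    and K: "j0 \<in> K" "j1 \<in> K" "j0 \<noteq> j1"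
  shows "\<exists>N D. real N = (real n - real M / (1 - real q)) * real q ^ i + real M / (1 - real q) \<and>
    (\<forall>t<M. perfect_coloring (hamming_graph \<Sigma> N) K
      (\<lambda>j l. S j l + (if j = l then (real N - real n - real i * real M) * (real q - 1) else 0)
        + real i * (real q - 1) * real (m l)) (D t)) \<and>
    (\<forall>x\<in>words \<Sigma> N. \<forall>j\<in>K. card {t. t < M \<and> D t x = j} = m j) \<and>
    (\<forall>p<N. essentially_depends \<Sigma> N (D 0) p)"
proof (induction i)
  case 0
  have "(\<lambda>j l. S j l + (if j = l then (real n - real n - real 0 * real M) * (real q - 1) else 0)
        + real 0 * (real q - 1) * real (m l)) = S"
    by (auto simp: fun_eq_iff)
  then show ?case
    using assms by (intro exI[of _ n] exI[of _ C]) auto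
next
  case (Suc i)
  define S' where "S' N i j l = S j l +
    (if j = l then (real N - real n - real i * real M) * (real q - 1) else 0)
    + real i * (real q - 1) * real (m l)" for N i j l
  obtain N and D :: "nat \<Rightarrow> 'a list \<Rightarrow> 'c" where
    N: "real N = (real n - real M / (1 - real q)) * real q ^ i + real M / (1 - real q)" and
    D: "\<And>t. t < M \<Longrightarrow> perfect_coloring (hamming_graph \<Sigma> N) K (S' N i) (D t)" and
    mD: "\<And>x j. x \<in> words \<Sigma> N \<Longrightarrow> j \<in> K \<Longrightarrow> card {t. t < M \<and> D t x = j} = m j" and
    depD: "\<And>p. p < N \<Longrightarrow> essentially_depends \<Sigma> N (D 0) p"
    using Suc unfolding S'_def by blast
  define N' where "N' = q * N + M"
  have "real N' = (real n - real M / (1 - real q)) * real q ^ Suc i + real M / (1 - real q)"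
  proof -
    \<comment> \<open>\<open>c\<close> is the fixed point of the recursion sending \<open>N\<close>
      to \<open>q * N + M\<close>, so the distance from \<open>c\<close> is multiplied by
      \<open>q\<close>.\<close>
    define c where "c = real M / (1 - real q)"
    have "c * (1 - real q) = real M"
      using q by (simp add: c_def)
    then have "real M = c - real q * c"
      by (simp add: algebra_simps)
    then show ?thesis
      by (simp add: N'_def N algebra_simps flip: c_def)
  qed
  moreover have "perfect_coloring (hamming_graph \<Sigma> N') K (S' N' (Suc i)) (lift N D s)" for s
    unfolding perfect_coloring_def coloring_def quotient_matrix_def pverts_hamming
  proof (intro conjI ballI impI)
    show "finite K"
      using perfect_coloringD(1)[OF D[OF M]] .
    show "lift N D s ` words \<Sigma> N' = K"
      unfolding N'_def by (intro lift_onto perfect_coloringD(2)[OF D])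
    fix j l w assume "j \<in> K" "l \<in> K" "w \<in> words \<Sigma> N'" "lift N D s w = j"
    \<comment> \<open>Multiplied by \<open>q - 1\<close>, the increment is
      \<open>(q - 1)\<^sup>2 * N\<close>, exactly the diagonal contribution of the unselected
      blocks.\<close>
    moreover have "real N' - real n - real (Suc i) * real M =
        (real N - real n - real i * real M) + (real q - 1) * real N"
      by (simp add: N'_def algebra_simps)
    ultimately show "real (card {v \<in> words \<Sigma> N'.
        (w, v) \<in> parcs (hamming_graph \<Sigma> N') \<and> lift N D s v = l}) = S' N' (Suc i) j l"
      using lift_neighbors[of w N l K "S' N i" D "m l" s] D mD
      by (simp add: N'_def S'_def power2_eq_square algebra_simps)
  qed
  moreover have "card {s. s < M \<and> lift N D s w = j} = m j" if "w \<in> words \<Sigma> N'" "j \<in> K" for w j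
    using that mD unfolding N'_def by (intro lift_count) auto
  moreover have "essentially_depends \<Sigma> N' (lift N D 0) p" if "p < N'" for p
    using that K depD perfect_coloringD(2)[OF D] unfolding N'_def
    by (intro lift_essentially_depends[of D N K j0 j1]) auto
  ultimately show ?case
    unfolding S'_def by blast
qed

end

section \<open>Multiplicities in a uniform collection, and the final result\<close>

text \<open>Double counting of the pairs of a vertex \<open>y\<close> and an index \<open>t\<close>
  with \<open>C t y = j\<close>: by uniformity each vertex contributes the same number, and each
  index contributes \<open>\<rho>\<close> times the number of vertices.\<close>

lemma uniform_collection_count:
  assumes \<Sigma>: "finite \<Sigma>"
    and u: "uniform_collection (hamming_graph \<Sigma> n) M C"
    and d: "\<And>t. t < M \<Longrightarrow> density (hamming_graph \<Sigma> n) (C t) j = \<rho>"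
    and x: "x \<in> words \<Sigma> n"
  shows "real (card {t. t < M \<and> C t x = j}) = real M * \<rho>"
proof -
  note fin = finite_words[OF \<Sigma>, of n]
  have count: "card {t. t < M \<and> C t y = j} = count {#C t y. t \<in># mset_set {..<M}#} j" for y
    by (auto simp: count_image_mset' sum.If_cases intro!: arg_cong[where f = card])
  have "card {t. t < M \<and> C t y = j} = card {t. t < M \<and> C t x = j}" if "y \<in> words \<Sigma> n" for y
  proof -
    have "{#C t y. t \<in># mset_set {..<M}#} = {#C t x. t \<in># mset_set {..<M}#}"
      using u x that unfolding uniform_collection_def pverts_hamming by blast
    then show ?thesis
      by (simp only: count)
  qed
  then have "card (words \<Sigma> n) * card {t. t < M \<and> C t x = j} =
      (\<Sum>y\<in>words \<Sigma> n. card {t \<in> {..<M}. C t y = j})"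
    by simp
  also have "\<dots> = (\<Sum>t<M. card {y \<in> words \<Sigma> n. C t y = j})"
    using fin by (intro sum_multicount_gen) auto
  also have "real \<dots> = (\<Sum>t<M. real (card (words \<Sigma> n)) * density (hamming_graph \<Sigma> n) (C t) j)"
    using x fin by (simp add: density_def card_gt_0_iff) (metis empty_iff)
  also have "\<dots> = real (card (words \<Sigma> n)) * (real M * \<rho>)"
    using d by simp
  finally show ?thesis
    using x fin by (auto simp: card_eq_0_iff)
qed

theorem corollary2:
  fixes n q M r :: nat
    and \<Sigma> :: "'a set"
    and K :: "'c set"
    and C :: "nat \<Rightarrow> 'a list \<Rightarrow> 'c"
    and E :: "'a list \<Rightarrow> nat"
    and S P I :: "'c \<Rightarrow> 'c \<Rightarrow> real"
    and T :: "nat \<Rightarrow> nat \<Rightarrow> real"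
  assumes "n > 0" and "q \<ge> 2" and "M > 0" and "r > 0"
    and "finite \<Sigma>" and "card \<Sigma> = q"
    and "finite K" and "card K = r"
    and "\<forall>t<M. perfect_coloring (hamming_graph \<Sigma> n) K S (C t)"
    and "uniform_collection (hamming_graph \<Sigma> n) M C"
    and "\<forall>p<n. essentially_depends \<Sigma> n (C 0) p"
    and "\<forall>j<M*q. \<forall>l<M*q. T j l = (if j mod q = l mod q then 0 else 1)"
    and "perfect_coloring (hamming_graph \<Sigma> M) {..<M*q} T E"
    and "\<forall>j\<in>K. \<forall>l\<in>K. I j l = (if j = l then 1 else 0)"
    and "\<forall>j\<in>K. corresponding_density_vector (hamming_graph \<Sigma> n) K S (P j)"
  shows "\<forall>i::nat. \<exists>N::nat.
    real N = (real n - real M / (1 - real q)) * real q ^ i + real M / (1 - real q) \<and>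
    (\<exists>D :: 'a list \<Rightarrow> 'c.
      perfect_coloring (hamming_graph \<Sigma> N) K
        (\<lambda>j l. S j l + (real N - real n - real i * real M) * (real q - 1) * I j l
                + real i * (real q - 1) * real M * P j l) D \<and>
      (\<forall>p<N. essentially_depends \<Sigma> N D p))"
proof
  fix i
  interpret selector_coloring q M \<Sigma> E T
    using assms by unfold_locales
  have C: "perfect_coloring (hamming_graph \<Sigma> n) K S (C t)" if "t < M" for t
    using assms that by blast
  \<comment> \<open>Since \<open>n > 0\<close>, there is a position to depend on; this yields the
    two distinct colors that the dependence on tail positions requires.\<close>
  have "essentially_depends \<Sigma> n (C 0) 0"
    using assms by blast
  then obtain x x' where x: "x \<in> words \<Sigma> n" "x' \<in> words \<Sigma> n" "C 0 x \<noteq> C 0 x'"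
    by (auto simp: essentially_depends_def)
  have K: "C 0 x \<in> K" "C 0 x' \<in> K"
    using x perfect_coloringD(2)[OF C[OF M]] by auto
  \<comment> \<open>Uniqueness of the density vector makes every row of \<open>P\<close> the density
    vector of every member of the collection.\<close>
  have P: "P j l = density (hamming_graph \<Sigma> n) (C t) l" if "j \<in> K" "l \<in> K" "t < M" for j l t
    using assms(15) that density_unique[OF \<Sigma>(1) _ C]
    by (metis (no_types, lifting) corresponding_density_vector_def)
  define m where "m l = card {t. t < M \<and> C t x = l}" for l
  have MP: "real (card {t. t < M \<and> C t y = l}) = real M * P j l"
    if "j \<in> K" "l \<in> K" "y \<in> words \<Sigma> n" for j l y
    using uniform_collection_count[OF \<Sigma>(1) assms(10)] P that by metis
  \<comment> \<open>The value \<open>real M * P j l\<close> does not involve the vertex, so the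
    multiplicities may be read off at \<open>x\<close>. The row \<open>C 0 x\<close> is just some
    element of \<open>K\<close>.\<close>
  have m: "card {t. t < M \<and> C t y = l} = m l" if "l \<in> K" "y \<in> words \<Sigma> n" for l y
    using MP[OF K(1) that] MP[OF K(1) that(1) x(1)] by (simp add: m_def)
  obtain N and D :: "nat \<Rightarrow> 'a list \<Rightarrow> 'c" where
    N: "real N = (real n - real M / (1 - real q)) * real q ^ i + real M / (1 - real q)" and
    D: "\<forall>t<M. perfect_coloring (hamming_graph \<Sigma> N) K
      (\<lambda>j l. S j l + (if j = l then (real N - real n - real i * real M) * (real q - 1) else 0)
        + real i * (real q - 1) * real (m l)) (D t)" and
    dep: "\<forall>p<N. essentially_depends \<Sigma> N (D 0) p"
    using iterated_lift[of n K S C m "C 0 x" "C 0 x'" i] C m assms(11) K x(3) by blast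
  have mP: "real (m l) = real M * P j l" if "j \<in> K" "l \<in> K" for j l
    using MP[OF that x(1)] by (simp add: m_def)
  have "perfect_coloring (hamming_graph \<Sigma> N) K
        (\<lambda>j l. S j l + (real N - real n - real i * real M) * (real q - 1) * I j l
                + real i * (real q - 1) * real M * P j l) (D 0)"
    by (rule perfect_coloring_cong[OF D[rule_format, OF M]]) (simp add: mP assms(14))
  then show "\<exists>N. real N = (real n - real M / (1 - real q)) * real q ^ i + real M / (1 - real q) \<and>
    (\<exists>D :: 'a list \<Rightarrow> 'c.
      perfect_coloring (hamming_graph \<Sigma> N) K
        (\<lambda>j l. S j l + (real N - real n - real i * real M) * (real q - 1) * I j l
                + real i * (real q - 1) * real M * P j l) D \<and>
      (\<forall>p<N. essentially_depends \<Sigma> N D p))"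
    using N dep by blast
qed

end
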